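(* (First shifting property.) Let $f:[0,\infty)^4\to\mathbb{C}$ be a function with quadruple Shehu transform $\mathbb{H}^4_{qrst}[f(q,r,s,t)]=F[(h,j,k,l),(m,n,o,p)]$, and let $a,b,c,d>0$. Then for all $h,j,k,l,m,n,o,p>0$ with $h>am$, $j>bn$, $k>co$, $l>dp$ such that $F$ exists at $[(h-am,\,j-bn,\,k-co,\,l-dp),(m,n,o,p)]$, $$\mathbb{H}^4_{qrst}\left[e^{aq+br+cs+dt}f(q,r,s,t)\right]=F[(h-am,\;j-bn,\;k-co,\;l-dp),(m,n,o,p)],$$ where the left-hand side is evaluated at the parameters $[(h,j,k,l),(m,n,o,p)]$.
   Context: Quadruple Shehu transform: for a real- or complex-valued function $f(q,r,s,t)$ of $q,r,s,t\ge 0$ and parameters (Shehu variables) $h,j,k,l,m,n,o,p>0$, $$\mathbb{H}^4_{qrst}[f(q,r,s,t)]=F[(h,j,k,l),(m,n,o,p)]=\int_0^\infty\int_0^\infty\int_0^\infty\int_0^\infty e^{-\left(\frac{hq}{m}+\frac{jr}{n}+\frac{ks}{o}+\frac{lt}{p}\right)}f(q,r,s,t)\,dq\,dr\,ds\,dt,$$ provided the integral exists (as a Lebesgue integral over $(0,\infty)^4$). *)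

theory Defs
  imports "HOL-Analysis.Analysis"
begin

text \<open>
  The third parameter of the second group, usually written as the letter between
  n and p, is called \<open>v\<close> here, since that letter is reserved as ASCII notation for composition.
  Functions on \<open>[0,\<infinity>)\<^sup>4\<close> are total functions on \<open>\<real>\<^sup>4\<close>; only their values on the open
  positive orthant enter the integral.
\<close>

definition pos_orthant4 :: "(real \<times> real \<times> real \<times> real) set" where
  "pos_orthant4 = {0<..} \<times> {0<..} \<times> {0<..} \<times> {0<..}"

fun shehu4_integrand ::
  "(real \<times> real \<times> real \<times> real \<Rightarrow> complex) \<Rightarrow>
   real \<times> real \<times> real \<times> real \<Rightarrow> real \<times> real \<times> real \<times> real \<Rightarrow>
   real \<times> real \<times> real \<times> real \<Rightarrow> complex" where
  "shehu4_integrand f (h, j, k, l) (m, n, v, p) (q, r, s, t) =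
     complex_of_real (exp (- (h * q / m + j * r / n + k * s / v + l * t / p))) * f (q, r, s, t)"

definition shehu4_exists ::
  "(real \<times> real \<times> real \<times> real \<Rightarrow> complex) \<Rightarrow>
   real \<times> real \<times> real \<times> real \<Rightarrow> real \<times> real \<times> real \<times> real \<Rightarrow> bool" where
  "shehu4_exists f x y \<longleftrightarrow> set_integrable lebesgue pos_orthant4 (shehu4_integrand f x y)"

text \<open>
  The Bochner integral is 0 for non-integrable functions, so \<open>shehu4 f x y\<close> is meaningful
  only together with \<open>shehu4_exists f x y\<close>.
\<close>

definition shehu4 ::
  "(real \<times> real \<times> real \<times> real \<Rightarrow> complex) \<Rightarrow>
   real \<times> real \<times> real \<times> real \<Rightarrow> real \<times> real \<times> real \<times> real \<Rightarrow> complex" where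
  "shehu4 f x y = set_lebesgue_integral lebesgue pos_orthant4 (shehu4_integrand f x y)"

end

theory Submission
  imports Defs
begin

text \<open>The factor \<open>exp (a * q + b * r + c * s + d * t)\<close> can be absorbed into the
  Shehu kernel: since \<open>a * q = (a * m) * q / m\<close>, and likewise in the other three
  variables, it only lowers \<open>h\<close> by \<open>a * m\<close>, \<open>j\<close> by
  \<open>b * n\<close>, and so on. The two integrands are therefore the same function, and
  \<open>shehu4_integrand_exp_shift\<close> says so on all of \<real>^4, not just on the orthant.
  Integrability and the value of the integral then transfer by rewriting, with no limit or change of
  variables.\<close>

lemma shehu4_integrand_exp_shift:
  assumes "m \<noteq> 0" "n \<noteq> 0" "v \<noteq> 0" "p \<noteq> 0"
  shows "shehu4_integrand
           (\<lambda>(q, r, s, t). complex_of_real (exp (a * q + b * r + c * s + d * t)) * f (q, r, s, t))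
           (h, j, k, l) (m, n, v, p) =
         shehu4_integrand f (h - a * m, j - b * n, k - c * v, l - d * p) (m, n, v, p)"
proof (rule ext, clarify)
  fix q r s t :: real
  \<comment> \<open>Comparison of the exponents; the nonzero denominators let
    \<open>a * m * q / m\<close> cancel to \<open>a * q\<close>.\<close>
  have "- (h * q / m + j * r / n + k * s / v + l * t / p) + (a * q + b * r + c * s + d * t) =
        - ((h - a * m) * q / m + (j - b * n) * r / n + (k - c * v) * s / v + (l - d * p) * t / p)"
    using assms by (simp add: left_diff_distrib diff_divide_distrib)
  then show "shehu4_integrand
           (\<lambda>(q, r, s, t). complex_of_real (exp (a * q + b * r + c * s + d * t)) * f (q, r, s, t))
           (h, j, k, l) (m, n, v, p) (q, r, s, t) =
         shehu4_integrand f (h - a * m, j - b * n, k - c * v, l - d * p) (m, n, v, p) (q, r, s, t)"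
    \<comment> \<open>Reassociating to the left brings the two real exponentials together, so that
      they merge into one under \<open>complex_of_real\<close>, with exactly the exponent on the
      left of the identity above.\<close>
    by (simp only: shehu4_integrand.simps prod.case mult.assoc[symmetric]
        of_real_mult[symmetric] exp_add[symmetric])
qed

theorem mainTheorem3:
  fixes f :: "real \<times> real \<times> real \<times> real \<Rightarrow> complex"
    and a b c d h j k l m n v p :: real
  assumes "a > 0" "b > 0" "c > 0" "d > 0"
    and "h > 0" "j > 0" "k > 0" "l > 0"
    and "m > 0" "n > 0" "v > 0" "p > 0"
    and "h > a * m" "j > b * n" "k > c * v" "l > d * p"
    and "shehu4_exists f (h - a * m, j - b * n, k - c * v, l - d * p) (m, n, v, p)"
  shows "shehu4_exists (\<lambda>(q, r, s, t). complex_of_real (exp (a * q + b * r + c * s + d * t)) * f (q, r, s, t))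
           (h, j, k, l) (m, n, v, p) \<and>
         shehu4 (\<lambda>(q, r, s, t). complex_of_real (exp (a * q + b * r + c * s + d * t)) * f (q, r, s, t))
           (h, j, k, l) (m, n, v, p) =
         shehu4 f (h - a * m, j - b * n, k - c * v, l - d * p) (m, n, v, p)"
  \<comment> \<open>With the integrands identified, the existence claim becomes the existence
    hypothesis and the equation of transforms becomes trivial. Positivity of \<open>m\<close>,
    \<open>n\<close>, \<open>v\<close>, \<open>p\<close> supplies the nonzero denominators.\<close>
  using assms shehu4_integrand_exp_shift[of m n v p a b c d f h j k l]
  by (simp add: shehu4_exists_def shehu4_def)

end
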